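(* Suppose $G \in \sigma\mathcal F$ is weakly $\mathcal F$-injective. Then Odd has a winning strategy in the game $\mathrm{BM}(\mathcal F, G)$.
   Context: Fix a countable first-order signature. $\mathcal F$ is a class, closed under isomorphisms, of countable finitely generated structures in this signature. $X \leq Y$ means that $X$ is a substructure of $Y$. $\sigma\mathcal F$ is the class of all structures of the form $\bigcup_{n\in\omega} X_n$, where $X_0 \leq X_1 \leq X_2 \leq \cdots$ is a chain of structures from $\mathcal F$. The game $\mathrm{BM}(\mathcal F, G)$: two players, Eve and Odd, alternately build a chain $A_0 \leq A_1 \leq A_2 \leq \cdots$ of structures from $\mathcal F$. Eve starts by choosing $A_0 \in \mathcal F$; Odd responds with $A_1 \in \mathcal F$, $A_1 \geq A_0$; Eve responds with $A_2 \in \mathcal F$, $A_2 \geq A_1$; and so on (Eve chooses $A_n$ for even $n$, Odd for odd $n$). Odd wins if $A_\infty = \bigcup_{n\in\omega} A_n$ is isomorphic to $G$; otherwise Eve wins. A strategy prescribes a player's move as a function of the finite sequence of previous moves; it is winning if the player wins every play in which it is followed. A structure $G \in \sigma\mathcal F$ is weakly $\mathcal F$-injective if every structure from $\mathcal F$ embeds into $G$ and, for every $A \leq G$ with $A \in \mathcal F$, there is $B \in \mathcal F$ such that $A \leq B \leq G$ and for every $X \in \mathcal F$ with $B \leq X$ there exists an embedding $f\colon X \to G$ with $f\restriction A = \mathrm{id}_A$. *)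

theory Defs
  imports Main "HOL-Library.Countable_Set"
begin

text \<open>Classes of structures are sets of structures with elements in a type \<open>'a\<close>. To have this agree with
  isomorphism-closed classes of countable structures in a set-theoretic universe, \<open>'a\<close> is meant to be
  uncountable: every countable structure then has a copy over \<open>'a\<close>, and there are always enough fresh
  elements to extend a countable structure (over a countable type, a player could exhaust the type).\<close>

text \<open>The sets of symbols (rather than whole types) form the signature, so that a purely relational
  or purely functional signature is possible. Constants are function symbols of arity 0.\<close>

record ('f, 'r) signature =
  Funs :: "'f set"
  Rels :: "'r set"
  fun_arity :: "'f \<Rightarrow> nat"
  rel_arity :: "'r \<Rightarrow> nat"

record ('a, 'f, 'r) fo_struct =
  univ :: "'a set"
  fun_in :: "'f \<Rightarrow> 'a list \<Rightarrow> 'a"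
  rel_in :: "'r \<Rightarrow> 'a list \<Rightarrow> bool"

definition countable_signature :: "('f, 'r) signature \<Rightarrow> bool" where
  "countable_signature L \<longleftrightarrow> countable (Funs L) \<and> countable (Rels L)"

definition fun_args :: "('f, 'r) signature \<Rightarrow> ('a, 'f, 'r) fo_struct \<Rightarrow> 'f \<Rightarrow> 'a list set" where
  "fun_args L M f = {xs. f \<in> Funs L \<and> length xs = fun_arity L f \<and> set xs \<subseteq> univ M}"

definition rel_args :: "('f, 'r) signature \<Rightarrow> ('a, 'f, 'r) fo_struct \<Rightarrow> 'r \<Rightarrow> 'a list set" where
  "rel_args L M r = {xs. r \<in> Rels L \<and> length xs = rel_arity L r \<and> set xs \<subseteq> univ M}"

text \<open>Interpretations have fixed default values at arguments that are not tuples of the right length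
  from the universe. Hence equality of records is equality of structures. The universe may be
  empty.\<close>

definition is_struct :: "('f, 'r) signature \<Rightarrow> ('a, 'f, 'r) fo_struct \<Rightarrow> bool" where
  "is_struct L M \<longleftrightarrow>
     (\<forall>f xs. xs \<in> fun_args L M f \<longrightarrow> fun_in M f xs \<in> univ M) \<and>
     (\<forall>f xs. xs \<notin> fun_args L M f \<longrightarrow> fun_in M f xs = undefined) \<and>
     (\<forall>r xs. rel_in M r xs \<longrightarrow> xs \<in> rel_args L M r)"

definition substr :: "('f, 'r) signature \<Rightarrow> ('a, 'f, 'r) fo_struct \<Rightarrow> ('a, 'f, 'r) fo_struct \<Rightarrow> bool" where
  "substr L M N \<longleftrightarrow> is_struct L M \<and> is_struct L N \<and> univ M \<subseteq> univ N \<and>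
     (\<forall>f. \<forall>xs \<in> fun_args L M f. fun_in M f xs = fun_in N f xs) \<and>
     (\<forall>r. \<forall>xs \<in> rel_args L M r. rel_in M r xs \<longleftrightarrow> rel_in N r xs)"

definition fo_embedding ::
    "('f, 'r) signature \<Rightarrow> ('a \<Rightarrow> 'b) \<Rightarrow> ('a, 'f, 'r) fo_struct \<Rightarrow> ('b, 'f, 'r) fo_struct \<Rightarrow> bool" where
  "fo_embedding L h M N \<longleftrightarrow> is_struct L M \<and> is_struct L N \<and>
     inj_on h (univ M) \<and> h ` univ M \<subseteq> univ N \<and>
     (\<forall>f. \<forall>xs \<in> fun_args L M f. h (fun_in M f xs) = fun_in N f (map h xs)) \<and>
     (\<forall>r. \<forall>xs \<in> rel_args L M r. rel_in M r xs \<longleftrightarrow> rel_in N r (map h xs))"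

definition fo_isomorphic ::
    "('f, 'r) signature \<Rightarrow> ('a, 'f, 'r) fo_struct \<Rightarrow> ('b, 'f, 'r) fo_struct \<Rightarrow> bool" where
  "fo_isomorphic L M N \<longleftrightarrow> (\<exists>h. fo_embedding L h M N \<and> h ` univ M = univ N)"

inductive_set generated ::
    "('f, 'r) signature \<Rightarrow> ('a, 'f, 'r) fo_struct \<Rightarrow> 'a set \<Rightarrow> 'a set"
  for L M S where
    base: "x \<in> S \<Longrightarrow> x \<in> generated L M S"
  | app: "\<lbrakk>f \<in> Funs L; length xs = fun_arity L f; \<forall>x \<in> set xs. x \<in> generated L M S\<rbrakk>
      \<Longrightarrow> fun_in M f xs \<in> generated L M S"

definition fin_generated :: "('f, 'r) signature \<Rightarrow> ('a, 'f, 'r) fo_struct \<Rightarrow> bool" where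
  "fin_generated L M \<longleftrightarrow> (\<exists>S. finite S \<and> S \<subseteq> univ M \<and> generated L M S = univ M)"

definition fg_class :: "('f, 'r) signature \<Rightarrow> ('a, 'f, 'r) fo_struct set \<Rightarrow> bool" where
  "fg_class L F \<longleftrightarrow>
     (\<forall>M \<in> F. is_struct L M \<and> countable (univ M) \<and> fin_generated L M) \<and>
     (\<forall>M \<in> F. \<forall>N. fo_isomorphic L M N \<longrightarrow> N \<in> F)"

definition struct_chain ::
    "('f, 'r) signature \<Rightarrow> ('a, 'f, 'r) fo_struct set \<Rightarrow> (nat \<Rightarrow> ('a, 'f, 'r) fo_struct) \<Rightarrow> bool" where
  "struct_chain L F X \<longleftrightarrow> (\<forall>n. X n \<in> F \<and> substr L (X n) (X (Suc n)))"

text \<open>For a chain of structures, any stage containing the arguments gives the same value of a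
  function symbol; the least one is taken.\<close>

definition chain_union :: "(nat \<Rightarrow> ('a, 'f, 'r) fo_struct) \<Rightarrow> ('a, 'f, 'r) fo_struct" where
  "chain_union X =
     \<lparr>univ = (\<Union>n. univ (X n)),
      fun_in = (\<lambda>f xs. if \<exists>n. set xs \<subseteq> univ (X n)
                       then fun_in (X (LEAST n. set xs \<subseteq> univ (X n))) f xs else undefined),
      rel_in = (\<lambda>r xs. \<exists>n. rel_in (X n) r xs)\<rparr>"

definition sigma_class ::
    "('f, 'r) signature \<Rightarrow> ('a, 'f, 'r) fo_struct set \<Rightarrow> ('a, 'f, 'r) fo_struct set" where
  "sigma_class L F = {chain_union X | X. struct_chain L F X}"

definition weakly_injective ::
    "('f, 'r) signature \<Rightarrow> ('a, 'f, 'r) fo_struct set \<Rightarrow> ('a, 'f, 'r) fo_struct \<Rightarrow> bool" where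
  "weakly_injective L F G \<longleftrightarrow> G \<in> sigma_class L F \<and>
     (\<forall>X \<in> F. \<exists>h. fo_embedding L h X G) \<and>
     (\<forall>A \<in> F. substr L A G \<longrightarrow>
        (\<exists>B \<in> F. substr L A B \<and> substr L B G \<and>
           (\<forall>X \<in> F. substr L B X \<longrightarrow>
              (\<exists>h. fo_embedding L h X G \<and> (\<forall>a \<in> univ A. h a = a)))))"

definition bm_position ::
    "('f, 'r) signature \<Rightarrow> ('a, 'f, 'r) fo_struct set \<Rightarrow> ('a, 'f, 'r) fo_struct list \<Rightarrow> bool" where
  "bm_position L F p \<longleftrightarrow>
     set p \<subseteq> F \<and> (\<forall>i. Suc i < length p \<longrightarrow> substr L (p ! i) (p ! Suc i))"

text \<open>Odd is to move exactly at the positions of odd length. A strategy prescribes a legal move at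
  each of them.\<close>

definition odd_strategy ::
    "('f, 'r) signature \<Rightarrow> ('a, 'f, 'r) fo_struct set \<Rightarrow>
     (('a, 'f, 'r) fo_struct list \<Rightarrow> ('a, 'f, 'r) fo_struct) \<Rightarrow> bool" where
  "odd_strategy L F s \<longleftrightarrow>
     (\<forall>p. bm_position L F p \<and> odd (length p) \<longrightarrow> bm_position L F (p @ [s p]))"

definition odd_follows ::
    "(('a, 'f, 'r) fo_struct list \<Rightarrow> ('a, 'f, 'r) fo_struct) \<Rightarrow>
     (nat \<Rightarrow> ('a, 'f, 'r) fo_struct) \<Rightarrow> bool" where
  "odd_follows s A \<longleftrightarrow> (\<forall>n. odd n \<longrightarrow> A n = s (map A [0..<n]))"

text \<open>The plays of the game are the infinite chains of structures from \<open>F\<close>.\<close>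

definition odd_winning_strategy ::
    "('f, 'r) signature \<Rightarrow> ('a, 'f, 'r) fo_struct set \<Rightarrow> ('a, 'f, 'r) fo_struct \<Rightarrow>
     (('a, 'f, 'r) fo_struct list \<Rightarrow> ('a, 'f, 'r) fo_struct) \<Rightarrow> bool" where
  "odd_winning_strategy L F G s \<longleftrightarrow> odd_strategy L F s \<and>
     (\<forall>A. struct_chain L F A \<and> odd_follows s A \<longrightarrow> fo_isomorphic L (chain_union A) G)"

end

theory Submission
  imports Defs
begin

text \<open>Write \<open>G\<close> as the union of a chain \<open>Y\<close>. Along a play, Odd keeps an embedding \<open>f\<^sub>k\<close> of his latest
  move \<open>M\<^sub>k\<close> into \<open>G\<close> and a set \<open>D\<^sub>k \<subseteq> M\<^sub>k\<close> containing Eve's latest move such that \<open>f\<^sub>k\<close> restricted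
  to \<open>D\<^sub>k\<close> extends to an embedding into \<open>G\<close> of whatever Eve may play next. If \<open>h\<close> is such an extension
  to Eve's next move \<open>X\<close>, then \<open>h\<close> maps \<open>X\<close> into some \<open>Y\<^sub>m\<close> with \<open>m > k\<close>, because \<open>X\<close> is finitely
  generated. Weak injectivity provides \<open>B\<close> with \<open>Y\<^sub>m \<le> B \<le> G\<close>, and Odd plays a copy of \<open>B\<close> extending
  \<open>X\<close> along \<open>h\<close>; the new set is the copy of \<open>Y\<^sub>m\<close>. The restrictions of \<open>f\<^sub>k\<close> to \<open>D\<^sub>k\<close> cohere, and their
  union is an isomorphism onto \<open>G\<close>, since \<open>f\<^sub>k ` D\<^sub>k \<supseteq> Y\<^sub>k\<close>.\<close>

section \<open>Substructures and embeddings\<close>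

lemma substr_structs: "substr L M N \<Longrightarrow> is_struct L M" "substr L M N \<Longrightarrow> is_struct L N"
  by (auto simp: substr_def)

lemma substr_univ: "substr L M N \<Longrightarrow> univ M \<subseteq> univ N"
  by (simp add: substr_def)

lemma fun_args_mono: "univ M \<subseteq> univ N \<Longrightarrow> xs \<in> fun_args L M f \<Longrightarrow> xs \<in> fun_args L N f"
  by (auto simp: fun_args_def)

lemma rel_args_mono: "univ M \<subseteq> univ N \<Longrightarrow> xs \<in> rel_args L M r \<Longrightarrow> xs \<in> rel_args L N r"
  by (auto simp: rel_args_def)

lemma fun_args_map:
  "h ` univ M \<subseteq> univ N \<Longrightarrow> xs \<in> fun_args L M f \<Longrightarrow> map h xs \<in> fun_args L N f"
  by (auto simp: fun_args_def)

lemma rel_args_map: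
  "h ` univ M \<subseteq> univ N \<Longrightarrow> xs \<in> rel_args L M r \<Longrightarrow> map h xs \<in> rel_args L N r"
  by (auto simp: rel_args_def)

lemma fun_args_set: "xs \<in> fun_args L M f \<Longrightarrow> set xs \<subseteq> univ M"
  by (simp add: fun_args_def)

lemma rel_args_set: "xs \<in> rel_args L M r \<Longrightarrow> set xs \<subseteq> univ M"
  by (simp add: rel_args_def)

lemma is_struct_fun_in: "is_struct L M \<Longrightarrow> xs \<in> fun_args L M f \<Longrightarrow> fun_in M f xs \<in> univ M"
  by (simp add: is_struct_def)

lemma substr_refl: "is_struct L M \<Longrightarrow> substr L M M"
  by (simp add: substr_def)

lemma substr_trans:
  assumes "substr L M N" "substr L N P"
  shows "substr L M P"
proof -
  have "univ M \<subseteq> univ N" using assms(1) by (rule substr_univ)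
  then show ?thesis
    using assms fun_args_mono[of M N _ L] rel_args_mono[of M N _ L]
    unfolding substr_def by (metis subset_trans)
qed

lemma substr_imp_embedding: "substr L M N \<Longrightarrow> fo_embedding L id M N"
  by (simp add: substr_def fo_embedding_def)

lemma fo_embedding_inj: "fo_embedding L h M N \<Longrightarrow> inj_on h (univ M)"
  by (simp add: fo_embedding_def)

lemma fo_embedding_image: "fo_embedding L h M N \<Longrightarrow> h ` univ M \<subseteq> univ N"
  by (simp add: fo_embedding_def)

lemma fo_embedding_comp:
  assumes g: "fo_embedding L g M N" and h: "fo_embedding L h N P"
  shows "fo_embedding L (h \<circ> g) M P"
proof -
  note im = fo_embedding_image[OF g] fo_embedding_image[OF h]
  have "inj_on (h \<circ> g) (univ M)"
    using fo_embedding_inj[OF g] fo_embedding_inj[OF h] im(1)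
    by (meson comp_inj_on inj_on_subset)
  moreover have "(h \<circ> g) ` univ M \<subseteq> univ P" using im by auto
  moreover have "(h \<circ> g) (fun_in M f xs) = fun_in P f (map (h \<circ> g) xs)"
    if "xs \<in> fun_args L M f" for f xs
    using that fun_args_map[OF im(1) that] g h by (simp add: fo_embedding_def)
  moreover have "rel_in M r xs \<longleftrightarrow> rel_in P r (map (h \<circ> g) xs)"
    if "xs \<in> rel_args L M r" for r xs
    using that rel_args_map[OF im(1) that] g h by (simp add: fo_embedding_def)
  ultimately show ?thesis using g h by (simp add: fo_embedding_def)
qed

lemma fo_embedding_substr:
  "substr L M N \<Longrightarrow> fo_embedding L h N P \<Longrightarrow> fo_embedding L h M P"
  using fo_embedding_comp[OF substr_imp_embedding] by fastforce

lemma fo_embedding_corestrict: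
  assumes h: "fo_embedding L h M P" and sub: "substr L N P" and im: "h ` univ M \<subseteq> univ N"
  shows "fo_embedding L h M N"
proof -
  have "h (fun_in M f xs) = fun_in N f (map h xs)" if "xs \<in> fun_args L M f" for f xs
    using that fun_args_map[OF im that] h sub by (simp add: fo_embedding_def substr_def)
  moreover have "rel_in M r xs \<longleftrightarrow> rel_in N r (map h xs)" if "xs \<in> rel_args L M r" for r xs
    using that rel_args_map[OF im that] h sub by (simp add: fo_embedding_def substr_def)
  ultimately show ?thesis
    using h im substr_structs[OF sub] by (simp add: fo_embedding_def)
qed

lemma fo_embedding_cong:
  assumes h: "fo_embedding L h M N" and eq: "\<And>x. x \<in> univ M \<Longrightarrow> h x = g x"
  shows "fo_embedding L g M N"
proof -
  have map_eq: "map g xs = map h xs" if "set xs \<subseteq> univ M" for xs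
    using that eq by (auto simp: subset_iff)
  have "inj_on g (univ M)" "g ` univ M \<subseteq> univ N"
    using fo_embedding_inj[OF h] fo_embedding_image[OF h] inj_on_cong[of "univ M" h g] eq by auto
  moreover have "g (fun_in M f xs) = fun_in N f (map g xs)" if "xs \<in> fun_args L M f" for f xs
    using that h eq is_struct_fun_in[of L M xs f] map_eq[OF fun_args_set[OF that]]
    by (metis fo_embedding_def)
  moreover have "rel_in M r xs \<longleftrightarrow> rel_in N r (map g xs)" if "xs \<in> rel_args L M r" for r xs
    using that h map_eq[OF rel_args_set[OF that]] by (metis fo_embedding_def)
  ultimately show ?thesis using h by (simp add: fo_embedding_def)
qed

lemma fo_embedding_inverse:
  assumes h: "fo_embedding L h M N" and surj: "h ` univ M = univ N"
  shows "fo_embedding L (inv_into (univ M) h) N M"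
proof -
  let ?g = "inv_into (univ M) h"
  have inj: "inj_on h (univ M)" by (rule fo_embedding_inj[OF h])
  have im: "?g ` univ N \<subseteq> univ M" using surj by (auto intro: inv_into_into)
  have map_eq: "map h (map ?g xs) = xs" if "set xs \<subseteq> univ N" for xs
    using that surj by (auto simp: subset_iff f_inv_into_f intro!: map_idI)
  have "inj_on ?g (univ N)" using surj by (simp add: inj_on_inv_into)
  moreover have "?g (fun_in N f xs) = fun_in M f (map ?g xs)" if "xs \<in> fun_args L N f" for f xs
  proof -
    have args: "map ?g xs \<in> fun_args L M f" by (rule fun_args_map[OF im that])
    then have "h (fun_in M f (map ?g xs)) = fun_in N f xs"
      using h map_eq[OF fun_args_set[OF that]] by (metis fo_embedding_def)
    then show ?thesis
      using inj args h is_struct_fun_in[OF _ args] by (metis fo_embedding_def inv_into_f_f)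
  qed
  moreover have "rel_in N r xs \<longleftrightarrow> rel_in M r (map ?g xs)" if "xs \<in> rel_args L N r" for r xs
    using rel_args_map[OF im that] h map_eq[OF rel_args_set[OF that]] by (metis fo_embedding_def)
  ultimately show ?thesis using h im by (simp add: fo_embedding_def)
qed

text \<open>Both structures are compared inside \<open>N\<close>: values computed in
  \<open>X\<close> and in \<open>M\<close> have the same image under \<open>f\<close>, and
  injectivity of \<open>f\<close> cancels it. This is how a pulled-back structure is recognized as
  an extension of \<open>X\<close>.\<close>

lemma substr_of_embeddings:
  assumes h: "fo_embedding L h X N" and f: "fo_embedding L f M N"
    and sub: "univ X \<subseteq> univ M" and eq: "\<And>x. x \<in> univ X \<Longrightarrow> f x = h x"
  shows "substr L X M"
proof -
  have f': "fo_embedding L f X N" by (rule fo_embedding_cong[OF h]) (simp add: eq)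
  have "fun_in X g xs = fun_in M g xs" if "xs \<in> fun_args L X g" for g xs
  proof (rule inj_onD[OF fo_embedding_inj[OF f]])
    note args = fun_args_mono[OF sub that]
    show "f (fun_in X g xs) = f (fun_in M g xs)"
      using f f' that args by (simp add: fo_embedding_def)
    show "fun_in X g xs \<in> univ M" "fun_in M g xs \<in> univ M"
      using f f' is_struct_fun_in[OF _ that] is_struct_fun_in[OF _ args] sub
      by (auto simp: fo_embedding_def)
  qed
  moreover have "rel_in X r xs \<longleftrightarrow> rel_in M r xs" if "xs \<in> rel_args L X r" for r xs
    using f f' that rel_args_mono[OF sub that] by (simp add: fo_embedding_def)
  ultimately show ?thesis using f f' sub by (auto simp: substr_def fo_embedding_def)
qed

section \<open>Copies of structures over fresh elements\<close>

definition pullback ::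
    "('f, 'r) signature \<Rightarrow> 'a set \<Rightarrow> ('a \<Rightarrow> 'b) \<Rightarrow> ('b, 'f, 'r) fo_struct \<Rightarrow> ('a, 'f, 'r) fo_struct" where
  "pullback L U f N = \<lparr>univ = U,
     fun_in = (\<lambda>g xs. if g \<in> Funs L \<and> length xs = fun_arity L g \<and> set xs \<subseteq> U
                      then inv_into U f (fun_in N g (map f xs)) else undefined),
     rel_in = (\<lambda>r xs. set xs \<subseteq> U \<and> rel_in N r (map f xs))\<rparr>"

lemma univ_pullback [simp]: "univ (pullback L U f N) = U"
  by (simp add: pullback_def)

lemma fo_embedding_pullback:
  assumes bij: "bij_betw f U (univ N)" and N: "is_struct L N"
  shows "fo_embedding L f (pullback L U f N) N"
proof -
  let ?M = "pullback L U f N"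
  have surj: "f ` U = univ N" and inj: "inj_on f U" using bij by (auto simp: bij_betw_def)
  have val: "fun_in N g (map f xs) \<in> f ` U" if "xs \<in> fun_args L ?M g" for g xs
    using is_struct_fun_in[OF N fun_args_map[OF _ that]] surj by simp
  have "is_struct L ?M"
    unfolding is_struct_def
  proof (intro conjI allI impI)
    fix g xs assume xs: "xs \<in> fun_args L ?M g"
    then have "fun_in ?M g xs = inv_into U f (fun_in N g (map f xs))"
      by (simp add: pullback_def fun_args_def)
    then show "fun_in ?M g xs \<in> univ ?M" using inv_into_into[OF val[OF xs]] by simp
  next
    fix g xs assume "xs \<notin> fun_args L ?M g"
    then show "fun_in ?M g xs = undefined" by (auto simp: pullback_def fun_args_def)
  next
    \<comment> \<open>The symbol and the arity are checked by \<open>N\<close> itself, whose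
      relations hold only of legal arguments.\<close>
    fix r xs assume "rel_in ?M r xs"
    then have "set xs \<subseteq> U" "map f xs \<in> rel_args L N r"
      using N by (auto simp: pullback_def is_struct_def)
    then show "xs \<in> rel_args L ?M r" by (auto simp: rel_args_def)
  qed
  moreover have "f (fun_in ?M g xs) = fun_in N g (map f xs)" if "xs \<in> fun_args L ?M g" for g xs
    using f_inv_into_f[OF val[OF that]] that by (simp add: pullback_def fun_args_def)
  moreover have "rel_in ?M r xs \<longleftrightarrow> rel_in N r (map f xs)" if "xs \<in> rel_args L ?M r" for r xs
    using that by (simp add: pullback_def rel_args_def)
  ultimately show ?thesis using N surj inj by (simp add: fo_embedding_def)
qed

text \<open>Uncountability of \<open>'a\<close> provides the fresh elements for \<open>univ N - h ` univ X\<close>.\<close>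

lemma extend_along_embedding:
  fixes X :: "('a, 'f, 'r) fo_struct" and N :: "('b, 'f, 'r) fo_struct"
  assumes "uncountable (UNIV :: 'a set)" and "countable (univ X)" and "countable (univ N)"
    and h: "fo_embedding L h X N"
  obtains M f where "substr L X M" "fo_embedding L f M N" "f ` univ M = univ N"
    "\<And>x. x \<in> univ X \<Longrightarrow> f x = h x"
proof -
  let ?R = "univ N - h ` univ X"
  have "uncountable (- univ X)"
    using assms(1,2) by (metis Compl_partition2 countable_Un_iff sup_commute)
  then obtain E where E: "E \<subseteq> - univ X" "infinite E" "countable E"
    using infinite_countable_subset'[OF uncountable_infinite] by metis
  have R: "countable ?R" using assms(3) by simp
  \<comment> \<open>\<open>e\<close> sends the points of \<open>N\<close> missed by \<open>h\<close>
    injectively to fresh elements: number the points, then enumerate \<open>E\<close>.\<close>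
  define e where "e = from_nat_into E \<circ> to_nat_on ?R"
  have e_inj: "inj_on e ?R"
    unfolding e_def
    using bij_betw_from_nat_into[OF E(3,2)] inj_on_to_nat_on[OF R]
    by (meson bij_betw_def comp_inj_on inj_on_subset subset_UNIV)
  have e_fresh: "e ` ?R \<subseteq> - univ X"
    using E from_nat_into[of E] by (fastforce simp: e_def)
  define U where "U = univ X \<union> e ` ?R"
  \<comment> \<open>Old points follow \<open>h\<close>; each fresh element returns to the point it
    was made for.\<close>
  define f where "f x = (if x \<in> univ X then h x else inv_into ?R e x)" for x
  have f_X: "f x = h x" if "x \<in> univ X" for x using that by (simp add: f_def)
  have f_e: "f (e y) = y" if "y \<in> ?R" for y
    using that e_fresh inv_into_f_f[OF e_inj that] by (auto simp: f_def)
  have "f ` univ X = h ` univ X" by (auto simp: f_X)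
  moreover have "f ` e ` ?R = ?R" using f_e by force
  ultimately have surj: "f ` U = univ N"
    using fo_embedding_image[OF h] by (auto simp: U_def image_Un)
  have "inj_on f (univ X)"
    using fo_embedding_inj[OF h] by (simp add: f_X inj_on_def)
  moreover have "inj_on f (e ` ?R)" by (rule inj_on_inverseI[of _ e]) (use f_e in force)
  moreover have "f ` univ X \<inter> f ` (e ` ?R) = {}"
    using \<open>f ` univ X = _\<close> \<open>f ` e ` ?R = _\<close> by auto
  ultimately have "inj_on f U"
    unfolding U_def inj_on_Un by blast
  with surj have bij: "bij_betw f U (univ N)" by (simp add: bij_betw_def)
  have N: "is_struct L N" using h by (simp add: fo_embedding_def)
  note emb = fo_embedding_pullback[OF bij N]
  have "substr L X (pullback L U f N)"
    by (rule substr_of_embeddings[OF h emb]) (auto simp: U_def f_X)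
  then show thesis using that[OF _ emb] surj f_X by simp
qed

section \<open>Unions of chains\<close>

lemma struct_chain_substr:
  assumes X: "struct_chain L F X" and "m \<le> n"
  shows "substr L (X m) (X n)"
  using \<open>m \<le> n\<close>
proof (induction rule: dec_induct)
  case base
  show ?case using X by (auto simp: struct_chain_def intro: substr_refl substr_structs)
next
  case (step n)
  then show ?case using X by (auto simp: struct_chain_def intro: substr_trans)
qed

text \<open>The stages increase, so finitely many points share one. The lower bound \<open>k\<close>
  lets the stage be taken beyond any prescribed one.\<close>

lemma struct_chain_finite_subset:
  assumes X: "struct_chain L F X" and "finite S" "S \<subseteq> (\<Union>n. univ (X n))"
  shows "\<exists>n\<ge>k. S \<subseteq> univ (X n)"
  using assms(2,3)
proof (induction S)
  case (insert a S)
  then obtain n m where "n \<ge> k" "S \<subseteq> univ (X n)" "a \<in> univ (X m)" by auto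
  then have "insert a S \<subseteq> univ (X (max n m))" "max n m \<ge> k"
    using substr_univ[OF struct_chain_substr[OF X, of n "max n m"]]
      substr_univ[OF struct_chain_substr[OF X, of m "max n m"]] by auto
  then show ?case by blast
qed auto

lemma univ_chain_union [simp]: "univ (chain_union X) = (\<Union>n. univ (X n))"
  by (simp add: chain_union_def)

text \<open>The least stage containing the arguments is a substructure of \<open>X n\<close>, so the
  two agree.\<close>

lemma fun_in_chain_union:
  assumes X: "struct_chain L F X" and xs: "xs \<in> fun_args L (X n) f"
  shows "fun_in (chain_union X) f xs = fun_in (X n) f xs"
proof -
  let ?l = "LEAST n. set xs \<subseteq> univ (X n)"
  have sub: "set xs \<subseteq> univ (X n)" by (rule fun_args_set[OF xs])
  have "?l \<le> n" using sub by (rule Least_le)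
  then have "substr L (X ?l) (X n)" by (rule struct_chain_substr[OF X])
  moreover have "xs \<in> fun_args L (X ?l) f"
    using xs LeastI[of "\<lambda>n. set xs \<subseteq> univ (X n)", OF sub] by (simp add: fun_args_def)
  ultimately have "fun_in (X ?l) f xs = fun_in (X n) f xs" by (simp add: substr_def)
  with sub show ?thesis by (auto simp: chain_union_def)
qed

text \<open>In \<open>chain_union\<close> a relation holds as soon as it holds at some stage
  \<open>X m\<close>; \<open>X m\<close> and \<open>X n\<close> are compared in the later of the
  two.\<close>

lemma rel_in_chain_union:
  assumes X: "struct_chain L F X" and xs: "xs \<in> rel_args L (X n) r"
  shows "rel_in (chain_union X) r xs \<longleftrightarrow> rel_in (X n) r xs"
proof -
  have "rel_in (X n) r xs" if m: "rel_in (X m) r xs" for m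
  proof -
    have "substr L (X m) (X (max m n))" "substr L (X n) (X (max m n))"
      using struct_chain_substr[OF X] by auto
    moreover have "xs \<in> rel_args L (X m) r"
      using m X by (auto simp: struct_chain_def substr_def is_struct_def)
    ultimately show ?thesis using m xs by (simp add: substr_def)
  qed
  then show ?thesis by (auto simp: chain_union_def)
qed

lemma fun_args_chain_union:
  assumes "struct_chain L F X" and "xs \<in> fun_args L (chain_union X) f"
  shows "\<exists>n. xs \<in> fun_args L (X n) f"
  using assms(2) struct_chain_finite_subset[OF assms(1), of "set xs" 0]
  by (auto simp: fun_args_def)

lemma rel_args_chain_union:
  assumes "struct_chain L F X" and "xs \<in> rel_args L (chain_union X) r"
  shows "\<exists>n. xs \<in> rel_args L (X n) r"
  using assms(2) struct_chain_finite_subset[OF assms(1), of "set xs" 0]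
  by (auto simp: rel_args_def)

lemma is_struct_chain_union:
  assumes X: "struct_chain L F X"
  shows "is_struct L (chain_union X)"
proof -
  have S: "is_struct L (X n)" for n using X by (auto simp: struct_chain_def substr_def)
  have sub: "univ (X n) \<subseteq> univ (chain_union X)" for n by auto
  show ?thesis
    unfolding is_struct_def
  proof (intro conjI allI impI)
    fix f xs assume "xs \<in> fun_args L (chain_union X) f"
    then obtain n where n: "xs \<in> fun_args L (X n) f" using fun_args_chain_union[OF X] by blast
    show "fun_in (chain_union X) f xs \<in> univ (chain_union X)"
      using is_struct_fun_in[OF S n] fun_in_chain_union[OF X n] sub by auto
  next
    fix f xs assume "xs \<notin> fun_args L (chain_union X) f"
    \<comment> \<open>No stage accepts \<open>xs\<close>, so both branches of the \<open>if\<close>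
      in \<open>chain_union\<close> give \<open>undefined\<close>.\<close>
    then have "xs \<notin> fun_args L (X n) f" for n using fun_args_mono[OF sub] by blast
    then show "fun_in (chain_union X) f xs = undefined"
      using S by (simp add: chain_union_def is_struct_def)
  next
    fix r xs assume "rel_in (chain_union X) r xs"
    then obtain n where "rel_in (X n) r xs" by (auto simp: chain_union_def)
    then have "xs \<in> rel_args L (X n) r" using S by (auto simp: is_struct_def)
    then show "xs \<in> rel_args L (chain_union X) r" by (rule rel_args_mono[OF sub])
  qed
qed

lemma substr_chain_union:
  assumes X: "struct_chain L F X"
  shows "substr L (X n) (chain_union X)"
  unfolding substr_def
  using X is_struct_chain_union[OF X] fun_in_chain_union[OF X] rel_in_chain_union[OF X]
  by (auto simp: struct_chain_def substr_def)

text \<open>Injectivity and preservation of symbols each concern finitely many elements at a time,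
  and these lie in a common stage.\<close>

lemma fo_embedding_chain_union:
  assumes X: "struct_chain L F X" and h: "\<And>n. fo_embedding L h (X n) N"
  shows "fo_embedding L h (chain_union X) N"
proof -
  have "inj_on h (\<Union>n. univ (X n))"
  proof (rule inj_onI)
    fix x y assume "x \<in> (\<Union>n. univ (X n))" "y \<in> (\<Union>n. univ (X n))" and eq: "h x = h y"
    then obtain n where "{x, y} \<subseteq> univ (X n)"
      using struct_chain_finite_subset[OF X, of "{x, y}"] by auto
    then show "x = y" using inj_onD[OF fo_embedding_inj[OF h] eq] by blast
  qed
  moreover have "h ` (\<Union>n. univ (X n)) \<subseteq> univ N"
    using fo_embedding_image[OF h] by blast
  moreover have "h (fun_in (chain_union X) f xs) = fun_in N f (map h xs)"
    if xs: "xs \<in> fun_args L (chain_union X) f" for f xs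
  proof -
    obtain n where n: "xs \<in> fun_args L (X n) f"
      using fun_args_chain_union[OF X xs] by blast
    then show ?thesis using h[of n] fun_in_chain_union[OF X n] by (simp add: fo_embedding_def)
  qed
  moreover have "rel_in (chain_union X) r xs \<longleftrightarrow> rel_in N r (map h xs)"
    if xs: "xs \<in> rel_args L (chain_union X) r" for r xs
  proof -
    obtain n where n: "xs \<in> rel_args L (X n) r"
      using rel_args_chain_union[OF X xs] by blast
    then show ?thesis using h[of n] rel_in_chain_union[OF X n] by (simp add: fo_embedding_def)
  qed
  ultimately show ?thesis
    using is_struct_chain_union[OF X] h[of 0] by (simp add: fo_embedding_def)
qed

text \<open>Some stage contains the images of the finitely many generators. Being closed under the
  operations of the union, it contains the image of everything they generate.\<close>

lemma fin_generated_embedding_chain_union: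
  assumes Y: "struct_chain L F Y" and "fin_generated L X"
    and h: "fo_embedding L h X (chain_union Y)"
  shows "\<exists>m\<ge>k. h ` univ X \<subseteq> univ (Y m)"
proof -
  obtain S where S: "finite S" "S \<subseteq> univ X" "generated L X S = univ X"
    using assms(2) by (auto simp: fin_generated_def)
  then have "h ` S \<subseteq> (\<Union>n. univ (Y n))"
    using fo_embedding_image[OF h] unfolding univ_chain_union by blast
  then obtain m where m: "m \<ge> k" "h ` S \<subseteq> univ (Y m)"
    using struct_chain_finite_subset[OF Y, of "h ` S"] S(1) by blast
  have "h x \<in> univ (Y m)" if "x \<in> generated L X S" for x
    using that
  proof induction
    case (base x)
    then show ?case using m(2) by auto
  next
    case (app f xs)
    then have X: "xs \<in> fun_args L X f" and Ym: "map h xs \<in> fun_args L (Y m) f"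
      using S(3) by (auto simp: fun_args_def)
    have "h (fun_in X f xs) = fun_in (chain_union Y) f (map h xs)"
      using h X by (simp add: fo_embedding_def)
    also have "\<dots> = fun_in (Y m) f (map h xs)" by (rule fun_in_chain_union[OF Y Ym])
    also have "\<dots> \<in> univ (Y m)"
      using is_struct_fun_in[OF _ Ym] Y by (auto simp: struct_chain_def substr_def)
    finally show ?case .
  qed
  with S(3) m(1) show ?thesis by auto
qed

section \<open>One round of the game\<close>

definition extendable ::
    "('f, 'r) signature \<Rightarrow> ('a, 'f, 'r) fo_struct \<Rightarrow> 'a set \<Rightarrow> ('a \<Rightarrow> 'a) \<Rightarrow>
     ('a, 'f, 'r) fo_struct \<Rightarrow> bool" where
  "extendable L G D f X \<longleftrightarrow> (\<exists>h. fo_embedding L h X G \<and> (\<forall>a\<in>D. h a = f a))"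

text \<open>\<open>Z\<close> is the part of \<open>G\<close> to be covered in this round;
  \<open>D\<close> and \<open>f\<close> are the commitment made before Eve's move \<open>X\<close>,
  and \<open>D'\<close> and \<open>f'\<close> the new one. The last conjunct is what the next round
  starts from.\<close>

definition good_response ::
    "('f, 'r) signature \<Rightarrow> ('a, 'f, 'r) fo_struct set \<Rightarrow> ('a, 'f, 'r) fo_struct \<Rightarrow> 'a set \<Rightarrow>
     'a set \<Rightarrow> ('a \<Rightarrow> 'a) \<Rightarrow> ('a, 'f, 'r) fo_struct \<Rightarrow>
     ('a, 'f, 'r) fo_struct \<times> 'a set \<times> ('a \<Rightarrow> 'a) \<Rightarrow> bool" where
  "good_response L F G Z D f X = (\<lambda>(M, D', f').
     M \<in> F \<and> substr L X M \<and> univ X \<subseteq> D' \<and> D' \<subseteq> univ M \<and> fo_embedding L f' M G \<and>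
     (\<forall>a\<in>D. f' a = f a) \<and> Z \<subseteq> f' ` D' \<and>
     (\<forall>X'\<in>F. substr L M X' \<longrightarrow> extendable L G D' f' X'))"

lemma good_response_exists:
  fixes G :: "('a, 'f, 'r) fo_struct"
  assumes unc: "uncountable (UNIV :: 'a set)" and F: "fg_class L F"
    and G: "weakly_injective L F G"
    and Y: "struct_chain L F Y" "G = chain_union Y"
    and X: "X \<in> F" "D \<subseteq> univ X" "extendable L G D f X"
  shows "\<exists>R. good_response L F G (univ (Y k)) D f X R"
proof -
  have cnt: "countable (univ M)" if "M \<in> F" for M using F that by (simp add: fg_class_def)
  have iso_F: "M \<in> F" if "N \<in> F" "fo_embedding L g M N" "g ` univ M = univ N" for M N g
  proof -
    have "inv_into (univ M) g ` univ N = univ M"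
      using that(3) fo_embedding_inj[OF that(2)] by (metis inv_into_image_cancel subset_refl)
    then have "fo_isomorphic L N M"
      using fo_embedding_inverse[OF that(2,3)] by (auto simp: fo_isomorphic_def)
    then show ?thesis using F that(1) by (auto simp: fg_class_def)
  qed
  obtain h where h: "fo_embedding L h X G" "\<And>a. a \<in> D \<Longrightarrow> h a = f a"
    using X(3) by (auto simp: extendable_def)
  \<comment> \<open>One stage serves twice: it holds the image of \<open>X\<close>, and by
    \<open>m \<ge> k\<close> it contains \<open>Y k\<close>.\<close>
  obtain m where m: "m \<ge> k" "h ` univ X \<subseteq> univ (Y m)"
    using fin_generated_embedding_chain_union[OF Y(1), of X h k] F X(1) h(1) Y(2)
    by (auto simp: fg_class_def)
  have "Y m \<in> F" "substr L (Y m) G"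
    using Y substr_chain_union[OF Y(1)] by (auto simp: struct_chain_def)
  \<comment> \<open>Weak injectivity at \<open>Y m\<close> keeps only the points of
    \<open>Y m\<close> fixed, not all of \<open>B\<close>. This is why \<open>D'\<close> below is
    the copy of \<open>Y m\<close> rather than all of \<open>univ M\<close>.\<close>
  then obtain B where B: "B \<in> F" "substr L (Y m) B" "substr L B G"
    and B_ext: "\<And>X'. X' \<in> F \<Longrightarrow> substr L B X' \<Longrightarrow>
      \<exists>g. fo_embedding L g X' G \<and> (\<forall>a\<in>univ (Y m). g a = a)"
    using G unfolding weakly_injective_def by blast
  have hB: "fo_embedding L h X B"
    using fo_embedding_corestrict[OF h(1) B(3)] m(2) substr_univ[OF B(2)] by blast
  obtain M f' where M: "substr L X M" "fo_embedding L f' M B" "f' ` univ M = univ B"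
    and f'_X: "\<And>x. x \<in> univ X \<Longrightarrow> f' x = h x"
    using extend_along_embedding[OF unc cnt[OF X(1)] cnt[OF B(1)] hB] by blast
  define g where "g = inv_into (univ M) f'"
  define D' where "D' = g ` univ (Y m)"
  have YB: "univ (Y m) \<subseteq> univ B" by (rule substr_univ[OF B(2)])
  have g: "fo_embedding L g B M" unfolding g_def by (rule fo_embedding_inverse[OF M(2,3)])
  have f'_g: "f' (g b) = b" if "b \<in> univ B" for b
    using that M(3) by (simp add: g_def f_inv_into_f)
  have "M \<in> F" by (rule iso_F[OF B(1) M(2,3)])
  moreover have "univ X \<subseteq> D'"
  proof
    fix x assume x: "x \<in> univ X"
    then have "g (h x) = x"
      using substr_univ[OF M(1)] fo_embedding_inj[OF M(2)] f'_X[OF x]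
      by (metis g_def inv_into_f_f subsetD)
    then show "x \<in> D'" using x m(2) by (force simp: D'_def)
  qed
  moreover have "D' \<subseteq> univ M" using YB fo_embedding_image[OF g] by (auto simp: D'_def)
  moreover have "fo_embedding L f' M G"
    using fo_embedding_comp[OF M(2) substr_imp_embedding[OF B(3)]] by simp
  moreover have "\<forall>a\<in>D. f' a = f a" using f'_X h(2) X(2) by auto
  moreover have "univ (Y k) \<subseteq> f' ` D'"
    using substr_univ[OF struct_chain_substr[OF Y(1) m(1)]] YB f'_g
    by (force simp: D'_def image_image)
  moreover have "extendable L G D' f' X'" if X': "X' \<in> F" "substr L M X'" for X'
  proof -
    \<comment> \<open>\<open>X'\<close> extends the copy \<open>M\<close> of \<open>B\<close>,
      whereas \<open>B_ext\<close> speaks of extensions of \<open>B\<close> itself. So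
      \<open>X'\<close> is replaced by a copy \<open>B'\<close> that contains \<open>B\<close>, and
      the embedding of \<open>B'\<close> is carried back along \<open>p\<close>.\<close>
    have gX': "fo_embedding L g B X'"
      using fo_embedding_comp[OF g substr_imp_embedding[OF X'(2)]] by simp
    obtain B' p where B': "substr L B B'" "fo_embedding L p B' X'" "p ` univ B' = univ X'"
      and p_B: "\<And>x. x \<in> univ B \<Longrightarrow> p x = g x"
      using extend_along_embedding[OF unc cnt[OF B(1)] cnt[OF X'(1)] gX'] by blast
    have "B' \<in> F" by (rule iso_F[OF X'(1) B'(2,3)])
    then obtain q where q: "fo_embedding L q B' G" "\<forall>a\<in>univ (Y m). q a = a"
      using B_ext B'(1) by blast
    let ?r = "q \<circ> inv_into (univ B') p"
    have "fo_embedding L ?r X' G"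
      by (rule fo_embedding_comp[OF fo_embedding_inverse[OF B'(2,3)] q(1)])
    \<comment> \<open>The inverse of \<open>p\<close> takes \<open>g b\<close> to \<open>b\<close>,
      which \<open>q\<close> fixes, and \<open>f'\<close> also takes \<open>g b\<close> to
      \<open>b\<close>.\<close>
    moreover have "?r (g b) = f' (g b)" if "b \<in> univ (Y m)" for b
    proof -
      have b: "b \<in> univ B" "b \<in> univ B'" using that YB substr_univ[OF B'(1)] by auto
      then have "inv_into (univ B') p (g b) = b"
        using p_B fo_embedding_inj[OF B'(2)] by (metis inv_into_f_f)
      then show ?thesis using q(2) that f'_g[OF b(1)] by simp
    qed
    ultimately show ?thesis by (auto simp: extendable_def D'_def)
  qed
  ultimately have "good_response L F G (univ (Y k)) D f X (M, D', f')"
    using M(1) by (simp add: good_response_def)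
  then show ?thesis by blast
qed

section \<open>Odd's strategy and its plays\<close>

text \<open>Odd's private data \<open>(M, D, f)\<close> after Eve's move \<open>A (2 * k)\<close>. Only the moves \<open>A (2 * i)\<close> with
  \<open>i \<le> k\<close> are consulted.\<close>

fun odd_data ::
    "('f, 'r) signature \<Rightarrow> ('a, 'f, 'r) fo_struct set \<Rightarrow> ('a, 'f, 'r) fo_struct \<Rightarrow>
     (nat \<Rightarrow> ('a, 'f, 'r) fo_struct) \<Rightarrow> (nat \<Rightarrow> ('a, 'f, 'r) fo_struct) \<Rightarrow> nat \<Rightarrow>
     ('a, 'f, 'r) fo_struct \<times> 'a set \<times> ('a \<Rightarrow> 'a)" where
  "odd_data L F G Y A 0 = (SOME R. good_response L F G (univ (Y 0)) {} undefined (A 0) R)"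
| "odd_data L F G Y A (Suc k) = (case odd_data L F G Y A k of (M, D, f) \<Rightarrow>
     SOME R. good_response L F G (univ (Y (Suc k))) D f (A (2 * Suc k)) R)"

text \<open>A position is passed to \<open>odd_data\<close> as \<open>(!) p\<close>, which is
  unspecified past the end of the list; those values must not influence the result.\<close>

lemma odd_data_cong:
  "(\<And>i. i \<le> 2 * k \<Longrightarrow> A i = A' i) \<Longrightarrow> odd_data L F G Y A k = odd_data L F G Y A' k"
  by (induction k) auto

text \<open>In positions that Odd's own strategy never produces, it repeats the last move.\<close>

definition copying_strategy ::
    "('f, 'r) signature \<Rightarrow> ('a, 'f, 'r) fo_struct set \<Rightarrow> ('a, 'f, 'r) fo_struct \<Rightarrow>
     (nat \<Rightarrow> ('a, 'f, 'r) fo_struct) \<Rightarrow> ('a, 'f, 'r) fo_struct list \<Rightarrow> ('a, 'f, 'r) fo_struct" where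
  "copying_strategy L F G Y p =
     (let M = fst (odd_data L F G Y ((!) p) (length p div 2))
      in if M \<in> F \<and> substr L (last p) M then M else last p)"

text \<open>Legality is demanded even where \<open>SOME\<close> may lack a witness; there the test
  in \<open>copying_strategy\<close> falls back on reflexivity of \<open>substr\<close>.\<close>

lemma odd_strategy_copying:
  assumes F: "fg_class L F"
  shows "odd_strategy L F (copying_strategy L F G Y)"
  unfolding odd_strategy_def
proof (intro allI impI)
  fix p assume p: "bm_position L F p \<and> odd (length p)"
  let ?M = "copying_strategy L F G Y p"
  from p have ne: "p \<noteq> []" by auto
  then have "last p \<in> F" using p by (auto simp: bm_position_def)
  then have M: "?M \<in> F" "substr L (last p) ?M"
    using F by (auto simp: copying_strategy_def Let_def fg_class_def intro: substr_refl)
  have "substr L ((p @ [?M]) ! i) ((p @ [?M]) ! Suc i)" if i: "i < length p" for i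
  proof (cases "Suc i = length p")
    case True
    then have "p ! i = last p" using ne by (metis diff_Suc_1 last_conv_nth)
    with True i M(2) show ?thesis by (simp add: nth_append)
  next
    case False
    with i p show ?thesis by (simp add: nth_append bm_position_def)
  qed
  with p M(1) show "bm_position L F (p @ [?M])" by (simp add: bm_position_def)
qed

lemma copying_strategy_wins:
  fixes G :: "('a, 'f, 'r) fo_struct"
  assumes unc: "uncountable (UNIV :: 'a set)" and F: "fg_class L F"
    and G: "weakly_injective L F G"
    and Y: "struct_chain L F Y" "G = chain_union Y"
    and A: "struct_chain L F A" and follows: "odd_follows (copying_strategy L F G Y) A"
  shows "fo_isomorphic L (chain_union A) G"
proof -
  define R where "R = odd_data L F G Y A"
  define D where "D k = fst (snd (R k))" for k
  define f where "f k = snd (snd (R k))" for k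
  have A_F: "A n \<in> F" for n using A by (simp add: struct_chain_def)
  have move: "A (Suc (2 * k)) = fst (R k)"
    if "fst (R k) \<in> F" "substr L (A (2 * k)) (fst (R k))" for k
  proof -
    let ?p = "map A [0..<Suc (2 * k)]"
    \<comment> \<open>The position has length \<open>2 * k + 1\<close>, so
      \<open>length ?p div 2\<close> is \<open>k\<close> and all entries consulted lie within the
      list.\<close>
    have "odd_data L F G Y ((!) ?p) k = R k"
      unfolding R_def by (rule odd_data_cong) (simp add: nth_append less_Suc_eq)
    moreover have "A (Suc (2 * k)) = copying_strategy L F G Y ?p"
      using follows by (simp add: odd_follows_def del: upt_Suc)
    ultimately show ?thesis using that by (simp add: copying_strategy_def Let_def)
  qed
  have good_move: "A (Suc (2 * k)) = fst (R k)"
    if "good_response L F G Z D0 f0 (A (2 * k)) (R k)" for k Z D0 f0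
    using that by (intro move) (auto simp: good_response_def)
  have R0: "good_response L F G (univ (Y 0)) {} undefined (A 0) (R 0)"
  proof -
    \<comment> \<open>Nothing is committed yet, so this only asks that \<open>A 0\<close> embed into
      \<open>G\<close>.\<close>
    have "extendable L G {} undefined (A 0)"
      using G A_F by (auto simp: weakly_injective_def extendable_def)
    then show ?thesis
      using good_response_exists[OF unc F G Y A_F[of 0], of "{}" undefined 0]
      by (simp add: R_def someI_ex)
  qed
  have step: "good_response L F G (univ (Y (Suc k))) (D k) (f k) (A (2 * Suc k)) (R (Suc k))"
    if good: "good_response L F G Z D0 f0 (A (2 * k)) (R k)" for k Z D0 f0
  proof -
    have next_move: "substr L (A (Suc (2 * k))) (A (2 * Suc k))"
      using A by (simp add: struct_chain_def)
    \<comment> \<open>Odd really did play \<open>fst (R k)\<close>, so Eve's next move extends it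
      and the last conjunct of \<open>good_response\<close> applies.\<close>
    have "D k \<subseteq> univ (A (2 * Suc k))" "extendable L G (D k) (f k) (A (2 * Suc k))"
      using good next_move substr_univ[OF next_move] A_F[of "2 * Suc k"] good_move[OF good]
      by (auto simp: good_response_def D_def f_def case_prod_beta)
    then show ?thesis
      using good_response_exists[OF unc F G Y A_F[of "2 * Suc k"], of "D k" "f k" "Suc k"]
      by (simp add: R_def D_def f_def case_prod_beta someI_ex)
  qed
  \<comment> \<open>Hiding the previous commitment gives the first round and all later ones a common
    form for the induction.\<close>
  have good: "\<exists>D0 f0. good_response L F G (univ (Y k)) D0 f0 (A (2 * k)) (R k)" for k
  proof (induction k)
    case 0
    then show ?case using R0 by auto
  next
    case (Suc k)
    then show ?case using step by blast
  qed
  have AD: "univ (A (2 * k)) \<subseteq> D k" and DA: "D k \<subseteq> univ (A (Suc (2 * k)))"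
    and emb: "fo_embedding L (f k) (A (Suc (2 * k))) G" and cover: "univ (Y k) \<subseteq> f k ` D k" for k
    using good[of k] good_move[of _ _ _ k]
    by (fastforce simp: good_response_def D_def f_def case_prod_beta)+
  \<comment> \<open>\<open>step\<close> names the old commitment that \<open>good\<close> hides,
    namely \<open>D k\<close> and \<open>f k\<close>, and so yields agreement on
    \<open>D k\<close>.\<close>
  have f_Suc: "f (Suc k) a = f k a" if "a \<in> D k" for k a
    using good[of k] step[of _ _ _ k] that
    by (fastforce simp: good_response_def D_def f_def case_prod_beta)
  have D_Suc: "D k \<subseteq> D (Suc k)" for k
  proof -
    have "univ (A (Suc (2 * k))) \<subseteq> univ (A (2 * Suc k))"
      by (rule substr_univ[OF struct_chain_substr[OF A]]) simp
    with DA[of k] AD[of "Suc k"] show ?thesis by blast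
  qed
  have f_le: "f n a = f k a" if "k \<le> n" "a \<in> D k" for k n a
    using that(1)
  proof (induction rule: dec_induct)
    case (step n)
    have "a \<in> D n" using lift_Suc_mono_le[of D, OF D_Suc step(1)] that(2) by blast
    then show ?case using f_Suc step.IH by simp
  qed simp
  \<comment> \<open>The maps \<open>f k\<close> agree on the growing sets \<open>D k\<close>;
    \<open>h\<close> is the union of these restrictions, the least index merely choosing a
    representative.\<close>
  define h where "h a = f (LEAST k. a \<in> D k) a" for a
  have h_D: "h a = f k a" if "a \<in> D k" for k a
    using f_le[of "LEAST k. a \<in> D k" k a] that unfolding h_def by (metis LeastI Least_le)
  have "fo_embedding L h (A n) G" for n
  proof -
    have "fo_embedding L (f n) (A n) G"
      by (rule fo_embedding_substr[OF struct_chain_substr[OF A] emb]) simp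
    \<comment> \<open>\<open>D n\<close> is only known to contain Eve's move
      \<open>A (2 * n)\<close>, so \<open>A n\<close> is placed inside that.\<close>
    moreover have "univ (A n) \<subseteq> D n"
      using AD[of n] substr_univ[OF struct_chain_substr[OF A, of n "2 * n"]] by auto
    ultimately show ?thesis using h_D by (metis fo_embedding_cong subsetD)
  qed
  then have h: "fo_embedding L h (chain_union A) G" by (rule fo_embedding_chain_union[OF A])
  \<comment> \<open>Round \<open>k\<close> has covered the whole stage \<open>Y k\<close>, and the
    stages exhaust \<open>G\<close>.\<close>
  have "univ G \<subseteq> h ` univ (chain_union A)"
  proof
    fix y assume "y \<in> univ G"
    then obtain k where "y \<in> univ (Y k)" using Y(2) by auto
    then obtain a where "a \<in> D k" "y = f k a" using cover by blast
    then show "y \<in> h ` univ (chain_union A)" using DA[of k] h_D by force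
  qed
  with h fo_embedding_image[OF h] show ?thesis by (auto simp: fo_isomorphic_def)
qed

theorem theorem3p3:
  fixes L :: "('f, 'r) signature"
    and F :: "('a, 'f, 'r) fo_struct set"
    and G :: "('a, 'f, 'r) fo_struct"
  assumes "uncountable (UNIV :: 'a set)"
    and "countable_signature L"
    and "fg_class L F"
    and "G \<in> sigma_class L F"
    and "weakly_injective L F G"
  shows "\<exists>s. odd_winning_strategy L F G s"
proof -
  obtain Y where Y: "struct_chain L F Y" "G = chain_union Y"
    using assms(4) by (auto simp: sigma_class_def)
  have "odd_winning_strategy L F G (copying_strategy L F G Y)"
    unfolding odd_winning_strategy_def
    using odd_strategy_copying[OF assms(3)] copying_strategy_wins[OF assms(1,3,5) Y] by blast
  then show ?thesis by blast
qed

end
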